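(* Let $\Gamma$ be a metrized graph. For any $p,q\in\Gamma$, $$\tau(\Gamma)=\frac14\int_\Gamma\Big(\frac{d}{dx}j_x(p,q)\Big)^2dx+\frac14 r(p,q).$$
   Context: A metrized graph $\Gamma$ is a finite connected graph (multiple edges and self-loops allowed) in which each edge is identified with a closed real interval of positive length; integration $dx$ is with respect to arclength and $d/dx$ is differentiation along edges with respect to the length parameter (defined away from finitely many points). Regard $\Gamma$ as a resistive circuit with each segment's resistance equal to its length. For $x,y,z\in\Gamma$, $j_z(x,y)$ denotes the potential at $x$ when unit current enters at $y$ and exits at $z$, with potential $0$ at $z$; $r(x,y)=j_x(y,y)$ is the effective resistance. The tau constant is $\tau(\Gamma)=\frac14\int_\Gamma\big(\frac{\partial}{\partial x}r(x,y)\big)^2dx$, which is independent of the choice of $y\in\Gamma$ (equivalently, $\tau(\Gamma)=\frac12 j_{\mu_{can}}(x,x)$ for the canonical measure $\mu_{can}$). *)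

theory Defs
  imports "HOL-Analysis.Analysis" "Graph_Theory.Digraph_Component"
begin

text \<open>
  The combinatorial model is a finite connected multigraph, given as a digraph with parallel arcs
  and loops allowed. The orientation of an arc \<open>e\<close> only fixes the parametrization of the
  corresponding edge by the interval \<open>[0, len e]\<close>, from \<open>tail\<close> to \<open>head\<close>.
\<close>

locale metrized_graph = fin_digraph G
  for G :: "('v, 'e) pre_digraph" +
  fixes len :: "'e \<Rightarrow> real"
  assumes connected_graph: "Digraph_Component.connected G"
    and len_pos: "e \<in> arcs G \<Longrightarrow> 0 < len e"

text \<open>
  The gluing of the edges at their end points is built into the representation: a point of the
  metrized graph is either a vertex or lies in the interior of exactly one edge.
\<close>

datatype ('v, 'e) mg_point = Vertex 'v | Inner 'e real

definition mg_points :: "('v, 'e) pre_digraph \<Rightarrow> ('e \<Rightarrow> real) \<Rightarrow> ('v, 'e) mg_point set" where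
  "mg_points G len = Vertex ` verts G \<union> {Inner e t | e t. e \<in> arcs G \<and> 0 < t \<and> t < len e}"

definition edge_point ::
    "('v, 'e) pre_digraph \<Rightarrow> ('e \<Rightarrow> real) \<Rightarrow> 'e \<Rightarrow> real \<Rightarrow> ('v, 'e) mg_point" where
  "edge_point G len e t =
     (if t \<le> 0 then Vertex (tail G e) else if t \<ge> len e then Vertex (head G e) else Inner e t)"

text \<open>
  A direction \<open>(e, t, \<sigma>)\<close> leaves the point with parameter \<open>t\<close> on the edge \<open>e\<close> towards larger
  (\<open>\<sigma> = 1\<close>) or smaller (\<open>\<sigma> = -1\<close>) parameters. A loop thus contributes two directions at its vertex.
\<close>

definition directions ::
    "('v, 'e) pre_digraph \<Rightarrow> ('e \<Rightarrow> real) \<Rightarrow> ('v, 'e) mg_point \<Rightarrow> ('e \<times> real \<times> real) set" where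
  "directions G len x =
     {(e, t, 1) | e t. e \<in> arcs G \<and> 0 \<le> t \<and> t < len e \<and> edge_point G len e t = x} \<union>
     {(e, t, -1) | e t. e \<in> arcs G \<and> 0 < t \<and> t \<le> len e \<and> edge_point G len e t = x}"

text \<open>
  Ohm's law: since resistance equals length, a potential \<open>f\<close> drives the current \<open>i\<close> in a given
  direction if \<open>f\<close> drops by \<open>i * s\<close> over every sufficiently short segment of length \<open>s\<close>.
\<close>

definition drives_current ::
    "('v, 'e) pre_digraph \<Rightarrow> ('e \<Rightarrow> real) \<Rightarrow> (('v, 'e) mg_point \<Rightarrow> real) \<Rightarrow>
     'e \<times> real \<times> real \<Rightarrow> real \<Rightarrow> bool" where
  "drives_current G len f d i \<longleftrightarrow> (case d of (e, t, \<sigma>) \<Rightarrow>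
     \<exists>\<epsilon>>0. \<forall>s\<in>{0..<\<epsilon>}. f (edge_point G len e t) - f (edge_point G len e (t + \<sigma> * s)) = i * s)"

text \<open>
  \<open>f\<close> is the potential, normalized to \<open>0\<close> at \<open>z\<close>, when unit current enters at \<open>y\<close> and exits
  at \<open>z\<close>: by Kirchhoff's law the current leaving any point along the edges equals the current
  injected there. (In terms of the Laplacian: \<open>f\<close> is continuous and piecewise affine with
  \<open>\<Delta> f = \<delta>\<^sub>y - \<delta>\<^sub>z\<close>.)
\<close>

definition unit_current_potential ::
    "('v, 'e) pre_digraph \<Rightarrow> ('e \<Rightarrow> real) \<Rightarrow> ('v, 'e) mg_point \<Rightarrow> ('v, 'e) mg_point \<Rightarrow>
     (('v, 'e) mg_point \<Rightarrow> real) \<Rightarrow> bool" where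
  "unit_current_potential G len y z f \<longleftrightarrow>
     f z = 0 \<and>
     (\<exists>i. \<forall>x\<in>mg_points G len.
        (\<forall>d\<in>directions G len x. drives_current G len f d (i d)) \<and>
        (\<Sum>d\<in>directions G len x. i d) = of_bool (x = y) - of_bool (x = z))"

text \<open>\<open>voltage G len z x y\<close> is \<open>j\<^sub>z(x, y)\<close>.\<close>

definition voltage ::
    "('v, 'e) pre_digraph \<Rightarrow> ('e \<Rightarrow> real) \<Rightarrow>
     ('v, 'e) mg_point \<Rightarrow> ('v, 'e) mg_point \<Rightarrow> ('v, 'e) mg_point \<Rightarrow> real" where
  "voltage G len z x y = (THE c. \<exists>f. unit_current_potential G len y z f \<and> f x = c)"

definition resistance ::
    "('v, 'e) pre_digraph \<Rightarrow> ('e \<Rightarrow> real) \<Rightarrow> ('v, 'e) mg_point \<Rightarrow> ('v, 'e) mg_point \<Rightarrow> real" where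
  "resistance G len x y = voltage G len x y y"

definition edge_deriv ::
    "('v, 'e) pre_digraph \<Rightarrow> ('e \<Rightarrow> real) \<Rightarrow> (('v, 'e) mg_point \<Rightarrow> real) \<Rightarrow> 'e \<Rightarrow> real \<Rightarrow> real" where
  "edge_deriv G len h e t = deriv (\<lambda>s. h (edge_point G len e s)) t"

text \<open>
  The integrand is given edge by edge in the arclength parameter; integrands such as
  \<open>(edge_deriv G len h)\<^sup>2\<close> need only be meaningful away from finitely many points.
\<close>

definition mg_integral ::
    "('v, 'e) pre_digraph \<Rightarrow> ('e \<Rightarrow> real) \<Rightarrow> ('e \<Rightarrow> real \<Rightarrow> real) \<Rightarrow> real" where
  "mg_integral G len g = (\<Sum>e\<in>arcs G. integral {0..len e} (g e))"

text \<open>The tau constant is the common value, over all base points \<open>y\<close>, of the defining integral.\<close>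

definition tau :: "('v, 'e) pre_digraph \<Rightarrow> ('e \<Rightarrow> real) \<Rightarrow> real" where
  "tau G len = (THE c. \<forall>y\<in>mg_points G len.
     c = 1/4 * mg_integral G len (\<lambda>e t. (edge_deriv G len (\<lambda>x. resistance G len x y) e t)\<^sup>2))"

end

theory Submission
  imports Defs
begin

text \<open>
  Ground a vertex \<open>r\<close> and let \<open>g(x, y) = j\<^sub>r(x, y)\<close> be the Green function, which is symmetric. It is
  the bilinear interpolation of its values on the vertices plus, for two points of one edge, the
  Green function of that edge with grounded end points; hence the diagonal \<open>Q(x) = g(x, x)\<close> is
  quadratic on every edge. By uniqueness of potentials,
  \<open>j\<^sub>x(p, q) = g(p, q) - g(x, p) - g(x, q) + Q(x)\<close>.
  Since \<open>\<Delta> g(\<cdot>, y) = \<delta>\<^sub>y - \<delta>\<^sub>r\<close>, integration by parts gives \<open>\<integral> g(\<cdot>, y)' h' = h(y) - h(r)\<close>. Expanding the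
  square of \<open>Q' - g(\<cdot>, p)' - g(\<cdot>, q)'\<close> therefore yields
  \<open>\<integral> (d/dx j\<^sub>x(p, q))\<^sup>2 dx = \<integral> Q'\<^sup>2 - r(p, q)\<close>, and the case \<open>p = q\<close> identifies \<open>\<integral> Q'\<^sup>2\<close> with \<open>4 \<tau>\<close>.
\<close>

section \<open>Linear algebra and calculus on an interval\<close>

text \<open>Gaussian elimination: a nonzero coefficient in one equation removes that equation
  together with one unknown, which keeps the strict inequality of cardinalities for the
  induction.\<close>

lemma underdetermined_homogeneous_system:
  fixes A :: "'i \<Rightarrow> 'j \<Rightarrow> real"
  assumes "finite I" "finite J" "card I < card J"
  shows "\<exists>x. (\<exists>j\<in>J. x j \<noteq> 0) \<and> (\<forall>i\<in>I. (\<Sum>j\<in>J. A i j * x j) = 0)"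
  using assms
proof (induction I arbitrary: J A rule: finite_induct)
  case empty
  then have "J \<noteq> {}" by auto
  then show ?case by (intro exI[of _ "\<lambda>_. 1"]) auto
next
  case (insert i I)
  show ?case
  proof (cases "\<forall>j\<in>J. A i j = 0")
    case True
    have "card I < card J" using insert by simp
    from insert.IH[OF insert.prems(1) this, of A] True show ?thesis by auto
  next
    case False
    then obtain k where k: "k \<in> J" "A i k \<noteq> 0" by auto
    \<comment> \<open>Row \<open>l\<close> after eliminating unknown \<open>k\<close> with the pivot
      \<open>A i k\<close>. Below, \<open>y\<close> recovers the value at \<open>k\<close> from
      equation \<open>i\<close>.\<close>
    define A' where "A' l j = A l j - A l k * A i j / A i k" for l j
    have "card I < card (J - {k})" using insert k by simp
    from insert.IH[OF _ this, of A'] insert.prems obtain x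
      where x: "\<exists>j\<in>J - {k}. x j \<noteq> 0" "\<forall>l\<in>I. (\<Sum>j\<in>J - {k}. A' l j * x j) = 0"
      by auto
    define s where "s = (\<Sum>j\<in>J - {k}. A i j * x j)"
    define y where "y = x(k := - s / A i k)"
    have sum_y: "(\<Sum>j\<in>J. A l j * y j) = (\<Sum>j\<in>J - {k}. A l j * x j) - A l k * s / A i k" for l
    proof -
      have "(\<Sum>j\<in>J. A l j * y j) = A l k * y k + (\<Sum>j\<in>J - {k}. A l j * y j)"
        using insert.prems k by (simp add: sum.remove)
      also have "(\<Sum>j\<in>J - {k}. A l j * y j) = (\<Sum>j\<in>J - {k}. A l j * x j)"
        by (rule sum.cong) (auto simp: y_def)
      finally show ?thesis by (simp add: y_def)
    qed
    have "(\<Sum>j\<in>J. A i j * y j) = 0"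
      using k by (simp add: sum_y) (simp add: s_def)
    moreover have "(\<Sum>j\<in>J. A l j * y j) = 0" if "l \<in> I" for l
    proof -
      have "(\<Sum>j\<in>J - {k}. A' l j * x j) = (\<Sum>j\<in>J - {k}. A l j * x j) - A l k * s / A i k"
        by (simp add: A'_def s_def algebra_simps sum_subtractf sum_distrib_left sum_divide_distrib)
      with x(2) that show ?thesis by (simp add: sum_y)
    qed
    moreover have "\<exists>j\<in>J. y j \<noteq> 0" using x(1) by (auto simp: y_def)
    ultimately show ?thesis by auto
  qed
qed

text \<open>The derivative is locally constant on the open interval, hence constant there. At the
  ends only one-sided affine behaviour is given, and matching it with the inner formula also
  identifies \<open>a\<close> and \<open>b\<close> with the common slope.\<close>

lemma affine_if_locally_affine:
  fixes \<phi> :: "real \<Rightarrow> real"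
  assumes l: "0 < l"
    and inner: "\<And>t. 0 < t \<Longrightarrow> t < l \<Longrightarrow> \<exists>\<epsilon>>0. \<exists>i. \<forall>u. \<bar>u - t\<bar> < \<epsilon> \<longrightarrow> \<phi> u = \<phi> t + i * (u - t)"
    and at0: "\<epsilon>0 > 0" "\<And>s. 0 \<le> s \<Longrightarrow> s < \<epsilon>0 \<Longrightarrow> \<phi> s = \<phi> 0 + a * s"
    and atl: "\<epsilon>1 > 0" "\<And>s. 0 \<le> s \<Longrightarrow> s < \<epsilon>1 \<Longrightarrow> \<phi> (l - s) = \<phi> l - b * s"
  shows "a = (\<phi> l - \<phi> 0) / l" "b = (\<phi> l - \<phi> 0) / l"
    "\<And>t. 0 < t \<Longrightarrow> t < l \<Longrightarrow> \<phi> t = \<phi> 0 + a * t"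
proof -
  have loc: "\<exists>\<epsilon>>0. \<forall>u. \<bar>u - t\<bar> < \<epsilon> \<longrightarrow> (\<phi> has_real_derivative deriv \<phi> t) (at u)" 
    if "0 < t" "t < l" for t
  proof -
    from inner[OF that] obtain \<epsilon> i where \<epsilon>: "\<epsilon> > 0" "\<And>u. \<bar>u - t\<bar> < \<epsilon> \<Longrightarrow> \<phi> u = \<phi> t + i * (u - t)"
      by blast
    have "(\<phi> has_real_derivative i) (at u)" if u: "\<bar>u - t\<bar> < \<epsilon>" for u
    proof (rule has_field_derivative_transform_within_open[where S = "ball t \<epsilon>"])
      show "((\<lambda>u. \<phi> t + i * (u - t)) has_real_derivative i) (at u)"
        by (auto intro!: derivative_eq_intros)
      show "\<phi> t + i * (v - t) = \<phi> v" if "v \<in> ball t \<epsilon>" for v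
        using that \<epsilon>(2)[of v] by (simp add: dist_real_def abs_minus_commute)
    qed (use u \<epsilon>(1) in \<open>auto simp: dist_real_def abs_minus_commute\<close>)
    moreover from this[of t] have "deriv \<phi> t = i" using \<epsilon>(1) by (simp add: DERIV_imp_deriv)
    ultimately show ?thesis using \<epsilon>(1) by auto
  qed
  have der: "(\<phi> has_real_derivative deriv \<phi> t) (at t)" if "0 < t" "t < l" for t
    using loc[OF that] by force
  have "(deriv \<phi> has_real_derivative 0) (at t)" if t: "0 < t" "t < l" for t
  proof -
    from loc[OF t] obtain \<epsilon> where \<epsilon>: "\<epsilon> > 0" "\<And>u. \<bar>u - t\<bar> < \<epsilon> \<Longrightarrow> deriv \<phi> u = deriv \<phi> t"
      using DERIV_imp_deriv by blast
    show ?thesis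
    proof (rule has_field_derivative_transform_within_open[where S = "ball t \<epsilon>"])
      show "((\<lambda>u. deriv \<phi> t) has_real_derivative 0) (at t)" by simp
      show "deriv \<phi> t = deriv \<phi> v" if "v \<in> ball t \<epsilon>" for v
        using that \<epsilon>(2)[of v] by (simp add: dist_real_def abs_minus_commute)
    qed (use \<epsilon>(1) in auto)
  qed
  then have "\<exists>c. \<forall>t\<in>{0<..<l}. deriv \<phi> t = c"
    by (intro has_field_derivative_zero_constant) (auto intro: has_field_derivative_at_within)
  then obtain c where c: "\<And>t. 0 < t \<Longrightarrow> t < l \<Longrightarrow> deriv \<phi> t = c" by auto
  have "((\<lambda>t. \<phi> t - c * t) has_real_derivative 0) (at t)" if "0 < t" "t < l" for t
    using DERIV_diff[OF der[OF that] DERIV_cmult_Id[of c]] c[OF that] by simp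
  then have "\<exists>k. \<forall>t\<in>{0<..<l}. \<phi> t - c * t = k"
    by (intro has_field_derivative_zero_constant) (auto intro: has_field_derivative_at_within)
  then obtain k where k: "\<And>t. 0 < t \<Longrightarrow> t < l \<Longrightarrow> \<phi> t = k + c * t" by (auto simp: algebra_simps)
  \<comment> \<open>With this choice both \<open>s\<close> and \<open>2 * s\<close> stay within the
    two end neighbourhoods and inside the interval. Two samples of an affine function determine its
    slope and its limiting end value.\<close>
  define s where "s = min (l / 3) (min (\<epsilon>0 / 3) (\<epsilon>1 / 3))"
  have s: "0 < s" "2 * s < l" "2 * s < \<epsilon>0" "2 * s < \<epsilon>1"
    using l at0(1) atl(1) by (auto simp: s_def min_def)
  have "\<phi> 0 + a * s = k + c * s" "\<phi> 0 + a * (2 * s) = k + c * (2 * s)"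
    using s k[of s] k[of "2 * s"] at0(2)[of s] at0(2)[of "2 * s"] by auto
  then have "a * s = c * s" "\<phi> 0 = k" by linarith+
  with s have 0: "a = c" "\<phi> 0 = k" by auto
  have "\<phi> l - b * s = k + c * (l - s)" "\<phi> l - b * (2 * s) = k + c * (l - 2 * s)"
    using s k[of "l - s"] k[of "l - 2 * s"] atl(2)[of s] atl(2)[of "2 * s"] by auto
  then have "b * s = c * s" "\<phi> l = k + c * l" by (simp_all only: right_diff_distrib)
  with s have "b = c" "\<phi> l = k + c * l" by auto
  with 0 l show "a = (\<phi> l - \<phi> 0) / l" "b = (\<phi> l - \<phi> 0) / l"
    "\<And>t. 0 < t \<Longrightarrow> t < l \<Longrightarrow> \<phi> t = \<phi> 0 + a * t" by (auto simp: k)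
qed

section \<open>Connectedness, discrete Laplacian and Dirichlet energy\<close>

context metrized_graph
begin

lemma edge_point_0 [simp]: "edge_point G len e 0 = Vertex (tail G e)"
  by (simp add: edge_point_def)

lemma edge_point_len [simp]: "e \<in> arcs G \<Longrightarrow> edge_point G len e (len e) = Vertex (head G e)"
  using len_pos[of e] by (simp add: edge_point_def)

lemma edge_point_in_mg_points [simp]: "e \<in> arcs G \<Longrightarrow> edge_point G len e t \<in> mg_points G len"
  by (auto simp: edge_point_def mg_points_def)

lemma mg_point_cases [consumes 1, case_names Vertex Inner]:
  assumes "x \<in> mg_points G len"
  obtains v where "x = Vertex v" "v \<in> verts G"
    | e t where "x = Inner e t" "e \<in> arcs G" "0 < t" "t < len e" "tail G e \<in> verts G" "head G e \<in> verts G"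
  using assms by (auto simp: mg_points_def)

lemma verts_nonempty: "verts G \<noteq> {}"
  using connected_graph unfolding Digraph_Component.connected_def strongly_connected_def by auto

text \<open>Connectedness means strong connectedness of the symmetrized digraph, so a path may
  traverse arcs backwards; equality along an arc serves both directions.\<close>

lemma constant_if_constant_on_arcs:
  assumes "\<And>e. e \<in> arcs G \<Longrightarrow> \<phi> (tail G e) = \<phi> (head G e)" and "u \<in> verts G" "v \<in> verts G"
  shows "\<phi> u = \<phi> v"
proof -
  have "u \<rightarrow>\<^sup>*\<^bsub>with_proj (mk_symmetric G)\<^esub> v"
    using connected_graph assms unfolding Digraph_Component.connected_def strongly_connected_def by auto
  then show ?thesis
    unfolding reachable_def
  proof (induction rule: rtrancl_on_induct)
    case (step a b)
    then show ?case using assms(1) by (auto simp: parcs_mk_symmetric)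
  qed auto
qed

text \<open>The graph Laplacian with conductances \<open>1 / len e\<close>, signed so that it is the
  net current leaving \<open>v\<close>. A loop occurs in both sums and contributes zero.\<close>

definition lap :: "('v \<Rightarrow> real) \<Rightarrow> 'v \<Rightarrow> real" where
  "lap \<phi> v = (\<Sum>e\<in>out_arcs G v. (\<phi> v - \<phi> (head G e)) / len e) +
             (\<Sum>e\<in>in_arcs G v. (\<phi> v - \<phi> (tail G e)) / len e)"

text \<open>The bilinear Dirichlet form; with equal arguments it is the power dissipated by the
  potential.\<close>

definition energy :: "('v \<Rightarrow> real) \<Rightarrow> ('v \<Rightarrow> real) \<Rightarrow> real" where
  "energy \<phi> \<eta> = (\<Sum>e\<in>arcs G. (\<phi> (head G e) - \<phi> (tail G e)) * (\<eta> (head G e) - \<eta> (tail G e)) / len e)"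

lemma energy_commute: "energy \<phi> \<eta> = energy \<eta> \<phi>"
  by (simp add: energy_def mult.commute)

lemma sum_out_arcs: "(\<Sum>v\<in>verts G. \<Sum>e\<in>out_arcs G v. F v e) = (\<Sum>e\<in>arcs G. F (tail G e) e)"
  for F :: "'v \<Rightarrow> 'e \<Rightarrow> real"
proof -
  have "(\<Sum>e\<in>out_arcs G v. F v e) = (\<Sum>e | e \<in> arcs G \<and> tail G e = v. F (tail G e) e)" for v
    by (rule sum.cong) (auto simp: out_arcs_def)
  then show ?thesis
    by (simp only:) (rule sum.group, auto)
qed

lemma sum_in_arcs: "(\<Sum>v\<in>verts G. \<Sum>e\<in>in_arcs G v. F v e) = (\<Sum>e\<in>arcs G. F (head G e) e)"
  for F :: "'v \<Rightarrow> 'e \<Rightarrow> real"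
proof -
  have "(\<Sum>e\<in>in_arcs G v. F v e) = (\<Sum>e | e \<in> arcs G \<and> head G e = v. F (head G e) e)" for v
    by (rule sum.cong) (auto simp: in_arcs_def)
  then show ?thesis
    by (simp only:) (rule sum.group, auto)
qed

text \<open>Summation by parts: each arc is counted once from its tail and once from its head, and
  the two contributions combine to the product of differences.\<close>

lemma energy_eq_sum_lap: "energy \<phi> \<eta> = (\<Sum>v\<in>verts G. lap \<phi> v * \<eta> v)"
proof -
  have "(\<Sum>v\<in>verts G. lap \<phi> v * \<eta> v) =
     (\<Sum>v\<in>verts G. \<Sum>e\<in>out_arcs G v. (\<phi> v - \<phi> (head G e)) / len e * \<eta> v) +
     (\<Sum>v\<in>verts G. \<Sum>e\<in>in_arcs G v. (\<phi> v - \<phi> (tail G e)) / len e * \<eta> v)"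
    by (simp add: lap_def distrib_right sum.distrib sum_distrib_right)
  also have "\<dots> = energy \<phi> \<eta>"
    unfolding sum_out_arcs sum_in_arcs energy_def sum.distrib[symmetric]
    by (rule sum.cong) (auto simp: divide_inverse algebra_simps)
  finally show ?thesis by simp
qed

lemma constant_if_energy_0:
  assumes "energy \<phi> \<phi> = 0" "u \<in> verts G" "v \<in> verts G"
  shows "\<phi> u = \<phi> v"
proof (rule constant_if_constant_on_arcs[OF _ assms(2,3)])
  fix e assume e: "e \<in> arcs G"
  have "\<forall>e\<in>arcs G. (\<phi> (head G e) - \<phi> (tail G e)) * (\<phi> (head G e) - \<phi> (tail G e)) / len e = 0"
    using assms(1) unfolding energy_def
    by (subst (asm) sum_nonneg_eq_0_iff) (auto intro!: divide_nonneg_pos len_pos)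
  then show "\<phi> (tail G e) = \<phi> (head G e)" using e len_pos[OF e] by auto
qed

lemma lap_add: "lap (\<lambda>v. \<phi> v + \<psi> v) u = lap \<phi> u + lap \<psi> u"
  by (simp add: lap_def sum.distrib[symmetric] add_divide_distrib diff_divide_distrib algebra_simps)

lemma lap_cmult: "lap (\<lambda>v. c * \<phi> v) u = c * lap \<phi> u"
  by (simp add: lap_def sum_distrib_left algebra_simps diff_divide_distrib)

lemma lap_sum: "finite J \<Longrightarrow> lap (\<lambda>v. \<Sum>j\<in>J. \<phi> j v) u = (\<Sum>j\<in>J. lap (\<phi> j) u)"
proof (induction J rule: finite_induct)
  case empty
  then show ?case by (simp add: lap_def)
next
  case (insert j J)
  then show ?case by (simp add: lap_add)
qed

section \<open>Potentials and Green kernel on the vertices\<close>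

text \<open>Ground \<open>r\<close> and demand harmonicity only away from \<open>r\<close> and
  \<open>b\<close>: this is one equation fewer than there are unknowns, so a nonzero solution
  exists. Its current at \<open>b\<close> cannot vanish, and rescaling makes that current
  one.\<close>

lemma discrete_potential_exists:
  assumes r: "r \<in> verts G" and b: "b \<in> verts G"
  shows "\<exists>\<phi>. \<phi> r = 0 \<and> (\<forall>v\<in>verts G. lap \<phi> v = of_bool (v = b) - of_bool (v = r))"
proof (cases "b = r")
  case True
  then show ?thesis by (intro exI[of _ "\<lambda>_. 0"]) (simp add: lap_def)
next
  case False
  let ?J = "verts G - {r}"
  have "card (?J - {b}) < card ?J"
    using False b by (intro card_Diff1_less) auto
  then obtain x where x: "\<exists>j\<in>?J. x j \<noteq> 0"
      "\<forall>i\<in>?J - {b}. (\<Sum>j\<in>?J. lap (\<lambda>u. of_bool (u = j)) i * x j) = 0"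
    using underdetermined_homogeneous_system[of "?J - {b}" ?J "\<lambda>i j. lap (\<lambda>u. of_bool (u = j)) i"]
    by auto
  define \<phi> where "\<phi> u = (\<Sum>j\<in>?J. x j * of_bool (u = j))" for u
  have \<phi>: "\<phi> u = (if u \<in> ?J then x u else 0)" for u
    by (simp add: \<phi>_def if_distrib of_bool_def cong: if_cong)
  have "lap \<phi> v = (\<Sum>j\<in>?J. lap (\<lambda>u. of_bool (u = j)) v * x j)" for v
    unfolding \<phi>_def by (simp only: lap_sum lap_cmult finite_verts finite_Diff mult.commute)
  then have harm: "lap \<phi> v = 0" if "v \<in> verts G" "v \<noteq> r" "v \<noteq> b" for v
    using x(2) that by simp
  have split: "(\<Sum>v\<in>verts G. F v) = F r + F b + (\<Sum>v\<in>verts G - {r} - {b}. F v)" for F :: "'v \<Rightarrow> real"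
    using r b False by (simp add: sum.remove)
  \<comment> \<open>Pairing with a constant shows that the total current is zero, so the currents at
    \<open>r\<close> and \<open>b\<close> are opposite.\<close>
  have "energy \<phi> (\<lambda>_. 1) = 0" by (simp add: energy_def)
  then have total: "lap \<phi> r + lap \<phi> b = 0"
    by (simp add: energy_eq_sum_lap split harm)
  \<comment> \<open>Otherwise the energy is zero, since the term at \<open>r\<close> has the factor
    \<open>\<phi> r\<close>, which is zero. Then \<open>\<phi>\<close> is constant, equal to its
    value at \<open>r\<close>, contradicting that it is nonzero somewhere.\<close>
  have "lap \<phi> b \<noteq> 0"
  proof
    assume "lap \<phi> b = 0"
    then have "energy \<phi> \<phi> = 0"
      by (simp add: energy_eq_sum_lap split harm \<phi>)
    moreover obtain j where "j \<in> verts G" "j \<noteq> r" "x j \<noteq> 0" using x(1) by auto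
    ultimately show False using constant_if_energy_0[of \<phi> j r] r by (simp add: \<phi>)
  qed
  moreover have "\<phi> r = 0" by (simp add: \<phi>)
  ultimately show ?thesis using total harm False
    by (intro exI[of _ "\<lambda>u. (1 / lap \<phi> b) * \<phi> u"])
       (auto simp only: lap_cmult, auto simp: field_simps)
qed

text \<open>The inverse of the Laplacian with row and column \<open>r\<close> deleted, extended by
  zero.\<close>

definition green_kernel :: "'v \<Rightarrow> ('v \<Rightarrow> 'v \<Rightarrow> real) \<Rightarrow> bool" where
  "green_kernel r \<gamma> \<longleftrightarrow> r \<in> verts G \<and> (\<forall>a\<in>verts G. \<forall>b\<in>verts G.
     \<gamma> a b = \<gamma> b a \<and> \<gamma> r b = 0 \<and> lap (\<lambda>a. \<gamma> a b) a = of_bool (a = b) - of_bool (a = r))"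

text \<open>Symmetry is the reciprocity law: the symmetric form
  \<open>energy (\<phi> b) (\<phi> a)\<close> evaluates to \<open>\<phi> a b\<close>, because
  \<open>\<phi> b\<close> has a unit source at \<open>b\<close> and \<open>\<phi> a\<close> vanishes
  at \<open>r\<close>.\<close>

lemma green_kernel_exists: "\<exists>r \<gamma>. green_kernel r \<gamma>"
proof -
  obtain r where r: "r \<in> verts G" using verts_nonempty by auto
  from discrete_potential_exists[OF r]
  have "\<forall>b. \<exists>\<phi>. b \<in> verts G \<longrightarrow> (\<phi> r = 0 \<and> (\<forall>v\<in>verts G. lap \<phi> v = of_bool (v = b) - of_bool (v = r)))"
    by blast
  then obtain \<phi> where \<phi>: "\<And>b. b \<in> verts G \<Longrightarrow> \<phi> b r = 0"
     "\<And>b v. b \<in> verts G \<Longrightarrow> v \<in> verts G \<Longrightarrow> lap (\<phi> b) v = of_bool (v = b) - of_bool (v = r)"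
    by metis
  have "energy (\<phi> b) (\<phi> a) = \<phi> a b" if "a \<in> verts G" "b \<in> verts G" for a b
  proof -
    have "energy (\<phi> b) (\<phi> a) = (\<Sum>v\<in>verts G. (of_bool (v = b) - of_bool (v = r)) * \<phi> a v)"
      unfolding energy_eq_sum_lap by (rule sum.cong) (auto simp: \<phi> that)
    also have "\<dots> = \<phi> a b - \<phi> a r"
      using that r by (simp add: left_diff_distrib sum_subtractf of_bool_def if_distrib[of "\<lambda>x. x * _"] cong: if_cong)
    finally show ?thesis using \<phi> that by simp
  qed
  then have "\<phi> a b = \<phi> b a" if "a \<in> verts G" "b \<in> verts G" for a b
    using energy_commute that by metis
  then have "green_kernel r (\<lambda>a b. \<phi> b a)"
    using r \<phi> by (auto simp: green_kernel_def)
  then show ?thesis by blast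
qed

section \<open>Directions, currents and Kirchhoff's law\<close>

lemma directions_Vertex:
  "directions G len (Vertex v) =
     (\<lambda>e. (e, 0, 1)) ` out_arcs G v \<union> (\<lambda>e. (e, len e, -1)) ` in_arcs G v"
  using len_pos by (fastforce simp: directions_def edge_point_def image_iff split: if_splits)

lemma edge_point_eq_Inner_iff:
  "edge_point G len e' s = Inner e t \<longleftrightarrow> e' = e \<and> s = t \<and> 0 < t \<and> t < len e"
  by (auto simp: edge_point_def)

lemma directions_Inner:
  assumes "e \<in> arcs G" "0 < t" "t < len e"
  shows "directions G len (Inner e t) = {(e, t, 1), (e, t, -1)}"
  using assms by (auto simp: directions_def edge_point_eq_Inner_iff)

lemma sum_directions_Vertex:
  "(\<Sum>d\<in>directions G len (Vertex v). i d) =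
     (\<Sum>e\<in>out_arcs G v. i (e, 0, 1)) + (\<Sum>e\<in>in_arcs G v. i (e, len e, -1))"
  for i :: "_ \<Rightarrow> real"
proof -
  have "(\<Sum>d\<in>directions G len (Vertex v). i d) =
     (\<Sum>d\<in>(\<lambda>e. (e, 0, 1)) ` out_arcs G v. i d) + (\<Sum>d\<in>(\<lambda>e. (e, len e, -1)) ` in_arcs G v. i d)"
    unfolding directions_Vertex by (rule sum.union_disjoint) auto
  then show ?thesis by (simp add: sum.reindex inj_on_def)
qed

text \<open>\<open>kirchhoff f D\<close> says that \<open>f\<close> is continuous and piecewise affine with \<open>\<Delta> f = D\<close>.\<close>

definition kirchhoff :: "(('v, 'e) mg_point \<Rightarrow> real) \<Rightarrow> (('v, 'e) mg_point \<Rightarrow> real) \<Rightarrow> bool" where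
  "kirchhoff f D \<longleftrightarrow> (\<exists>i. \<forall>x\<in>mg_points G len.
     (\<forall>d\<in>directions G len x. drives_current G len f d (i d)) \<and> (\<Sum>d\<in>directions G len x. i d) = D x)"

lemma unit_current_potential_iff:
  "unit_current_potential G len y z f \<longleftrightarrow>
     f z = 0 \<and> kirchhoff f (\<lambda>x. of_bool (x = y) - of_bool (x = z))"
  by (simp add: unit_current_potential_def kirchhoff_def)

lemma drives_current_lincomb:
  assumes "drives_current G len f d i" "drives_current G len g d j"
  shows "drives_current G len (\<lambda>x. a * f x + b * g x + c) d (a * i + b * j)"
proof -
  obtain e t \<sigma> where d: "d = (e, t, \<sigma>)" by (cases d)
  from assms obtain \<epsilon> \<delta> where ed: "\<epsilon> > 0" "\<delta> > 0"
    and f: "\<And>s. s \<in> {0..<\<epsilon>} \<Longrightarrow> f (edge_point G len e (t + \<sigma> * s)) = f (edge_point G len e t) - i * s"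
    and g: "\<And>s. s \<in> {0..<\<delta>} \<Longrightarrow> g (edge_point G len e (t + \<sigma> * s)) = g (edge_point G len e t) - j * s"
    unfolding drives_current_def d by (force simp: algebra_simps)
  show ?thesis unfolding drives_current_def d using ed
    by (auto intro!: exI[of _ "min \<epsilon> \<delta>"] simp: f g) (simp add: algebra_simps)
qed

text \<open>Superposition. The constant \<open>c\<close> is free because currents depend only on
  potential differences; it allows the grounded point to be moved.\<close>

lemma kirchhoff_lincomb:
  assumes "kirchhoff f D" "kirchhoff g E"
  shows "kirchhoff (\<lambda>x. a * f x + b * g x + c) (\<lambda>x. a * D x + b * E x)"
proof -
  from assms obtain i j where
    i: "\<And>x. x \<in> mg_points G len \<Longrightarrow>
     (\<forall>d\<in>directions G len x. drives_current G len f d (i d)) \<and> (\<Sum>d\<in>directions G len x. i d) = D x" and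
    j: "\<And>x. x \<in> mg_points G len \<Longrightarrow>
     (\<forall>d\<in>directions G len x. drives_current G len g d (j d)) \<and> (\<Sum>d\<in>directions G len x. j d) = E x"
    unfolding kirchhoff_def by metis
  then show ?thesis unfolding kirchhoff_def
    by (intro exI[of _ "\<lambda>d. a * i d + b * j d"])
       (auto intro!: drives_current_lincomb simp: sum.distrib sum_distrib_left[symmetric])
qed

lemma kirchhoff_cong_rhs:
  "kirchhoff f D \<Longrightarrow> (\<And>x. x \<in> mg_points G len \<Longrightarrow> D x = E x) \<Longrightarrow> kirchhoff f E"
  unfolding kirchhoff_def by auto

text \<open>The sign of a direction takes only two values, so the currents are given by two
  functions of edge and parameter: \<open>R\<close> for increasing and \<open>L\<close> for
  decreasing parameter.\<close>

lemma kirchhoffI: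
  assumes right: "\<And>e t. e \<in> arcs G \<Longrightarrow> 0 \<le> t \<Longrightarrow> t < len e \<Longrightarrow> drives_current G len f (e, t, 1) (R e t)"
    and left: "\<And>e t. e \<in> arcs G \<Longrightarrow> 0 < t \<Longrightarrow> t \<le> len e \<Longrightarrow> drives_current G len f (e, t, -1) (L e t)"
    and vertex: "\<And>v. v \<in> verts G \<Longrightarrow>
      (\<Sum>e\<in>out_arcs G v. R e 0) + (\<Sum>e\<in>in_arcs G v. L e (len e)) = D (Vertex v)"
    and inner: "\<And>e t. e \<in> arcs G \<Longrightarrow> 0 < t \<Longrightarrow> t < len e \<Longrightarrow> R e t + L e t = D (Inner e t)"
  shows "kirchhoff f D"
  unfolding kirchhoff_def
proof (intro exI ballI conjI)
  let ?i = "\<lambda>(e, t, \<sigma>). if \<sigma> = 1 then R e t else L e t"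
  fix x assume x: "x \<in> mg_points G len"
  show "drives_current G len f d (?i d)" if "d \<in> directions G len x" for d
    using that left right by (auto simp: directions_def)
  from x show "(\<Sum>d\<in>directions G len x. ?i d) = D x"
  proof (cases rule: mg_point_cases)
    case (Vertex v)
    then show ?thesis using vertex by (simp add: sum_directions_Vertex)
  next
    case (Inner e t)
    then show ?thesis using inner by (simp add: directions_Inner)
  qed
qed

text \<open>Current flows down the potential, so towards larger parameters it is minus the slope. In
  the leftward companion it is the slope itself.\<close>

lemma drives_current_rightI:
  assumes "0 \<le> t" "t < b" and "\<And>u. t \<le> u \<Longrightarrow> u < b \<Longrightarrow> f (edge_point G len e u) = \<phi> - i * u"
  shows "drives_current G len f (e, t, 1) i"
  unfolding drives_current_def using assms
  by (auto intro!: exI[of _ "b - t"]) (simp add: algebra_simps)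

lemma drives_current_leftI:
  assumes "a < t" and "\<And>u. a < u \<Longrightarrow> u \<le> t \<Longrightarrow> f (edge_point G len e u) = \<phi> + i * u"
  shows "drives_current G len f (e, t, -1) i"
  unfolding drives_current_def using assms
  by (auto intro!: exI[of _ "t - a"]) (simp add: algebra_simps)

section \<open>Explicit potentials: interpolation and hat functions\<close>

text \<open>For a fixed point this is also a linear functional of \<open>\<phi>\<close>: it replaces
  the point by a weighted combination of the ends of its edge. Both readings are used.\<close>

primrec interp :: "('v \<Rightarrow> real) \<Rightarrow> ('v, 'e) mg_point \<Rightarrow> real" where
  "interp \<phi> (Vertex v) = \<phi> v"
| "interp \<phi> (Inner e t) = (1 - t / len e) * \<phi> (tail G e) + t / len e * \<phi> (head G e)"

lemma interp_edge_point:
  assumes "e \<in> arcs G" "0 \<le> t" "t \<le> len e"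
  shows "interp \<phi> (edge_point G len e t) = (1 - t / len e) * \<phi> (tail G e) + t / len e * \<phi> (head G e)"
  using assms len_pos[of e] by (auto simp: edge_point_def)

text \<open>The slope is constant along an edge, so currents cancel at inner points, while at a
  vertex they add up to the discrete Laplacian.\<close>

lemma kirchhoff_interp: "kirchhoff (interp \<phi>) (case_mg_point (lap \<phi>) (\<lambda>_ _. 0))"
proof (rule kirchhoffI)
  let ?i = "\<lambda>e. (\<phi> (tail G e) - \<phi> (head G e)) / len e"
  fix e t assume e: "e \<in> arcs G"
  show "drives_current G len (interp \<phi>) (e, t, 1) (?i e)" if "0 \<le> t" "t < len e"
    using that e len_pos[OF e]
    by (intro drives_current_rightI[of t "len e" _ _ "\<phi> (tail G e)"])
       (auto simp: interp_edge_point field_simps)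
  show "drives_current G len (interp \<phi>) (e, t, -1) (- ?i e)" if "0 < t" "t \<le> len e"
    using that e len_pos[OF e]
    by (intro drives_current_leftI[of 0 t _ _ "\<phi> (tail G e)"])
       (auto simp: interp_edge_point field_simps)
qed (auto simp: lap_def diff_divide_distrib)

text \<open>The Green function of an edge with both end points grounded.\<close>

definition tent :: "'e \<Rightarrow> real \<Rightarrow> real \<Rightarrow> real" where
  "tent e c t = min c t * (len e - max c t) / len e"

fun hat :: "('v, 'e) mg_point \<Rightarrow> ('v, 'e) mg_point \<Rightarrow> real" where
  "hat (Inner e t) (Inner e' c) = (if e = e' then tent e c t else 0)"
| "hat _ _ = 0"

lemma hat_Vertex [simp]: "hat x (Vertex v) = 0"
  by (cases x) auto

lemma hat_commute: "hat x y = hat y x"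
  by (cases x; cases y) (auto simp: tent_def min.commute max.commute)

lemma hat_edge_point:
  assumes "e \<in> arcs G" "0 \<le> t" "t \<le> len e" "0 < c" "c < len e'"
  shows "hat (edge_point G len e t) (Inner e' c) = (if e = e' then tent e c t else 0)"
  using assms len_pos[of e] by (auto simp: edge_point_def tent_def)

text \<open>A unit current injected at parameter \<open>c\<close> splits between the grounded ends
  in inverse proportion to their distances, so the sinks are the interpolation weights of the
  point.\<close>

lemma kirchhoff_hat:
  assumes e: "e \<in> arcs G" and c: "0 < c" "c < len e"
  shows "kirchhoff (\<lambda>x. hat x (Inner e c))
    (\<lambda>x. of_bool (x = Inner e c) - (1 - c / len e) * of_bool (x = Vertex (tail G e)) - c / len e * of_bool (x = Vertex (head G e)))"
proof (rule kirchhoffI)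
  let ?f = "\<lambda>x. hat x (Inner e c)"
  \<comment> \<open>\<open>?R\<close> is minus the slope just after \<open>t\<close>,
    \<open>?L\<close> the slope just before it. At the kink \<open>t = c\<close> they see different
    sides, hence \<open><\<close> in one and \<open>\<le>\<close> in the other, and there they add
    up to one.\<close>
  let ?R = "\<lambda>e' t. if e' = e then if t < c then c / len e - 1 else c / len e else 0"
  let ?L = "\<lambda>e' t. if e' = e then if t \<le> c then 1 - c / len e else - c / len e else 0"
  fix e' t assume e': "e' \<in> arcs G"
  note pos = len_pos[OF e]
  show "drives_current G len ?f (e', t, 1) (?R e' t)" if "0 \<le> t" "t < len e'"
    using that e' c pos
    \<comment> \<open>The affine piece ends at the kink or at the end of the edge; its intercept is
      \<open>0\<close> before the kink and \<open>c\<close> after it.\<close>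
    by (intro drives_current_rightI[of t "if e' = e \<and> t < c then c else len e'" _ _ "if e' = e \<and> c \<le> t then c else 0"])
       (auto simp: hat_edge_point tent_def field_simps split: if_splits)
  show "drives_current G len ?f (e', t, -1) (?L e' t)" if "0 < t" "t \<le> len e'"
    using that e' c pos
    by (intro drives_current_leftI[of "if e' = e \<and> c < t then c else 0" t _ _ "if e' = e \<and> c < t then c else 0"])
       (auto simp: hat_edge_point tent_def field_simps split: if_splits)
  show "?R e' t + ?L e' t = of_bool (Inner e' t = Inner e c) -
        (1 - c / len e) * of_bool (Inner e' t = Vertex (tail G e)) - c / len e * of_bool (Inner e' t = Vertex (head G e))"
    using pos by (auto simp: field_simps)
next
  fix v
  show "(\<Sum>e'\<in>out_arcs G v. if e' = e then if 0 < c then c / len e - 1 else c / len e else 0) +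
     (\<Sum>e'\<in>in_arcs G v. if e' = e then if len e' \<le> c then 1 - c / len e else - c / len e else 0) =
     of_bool (Vertex v = Inner e c) - (1 - c / len e) * of_bool (Vertex v = Vertex (tail G e))
     - c / len e * of_bool (Vertex v = Vertex (head G e))"
  proof -
    have "(\<Sum>e'\<in>in_arcs G v. if e' = e then if len e' \<le> c then 1 - c / len e else - c / len e else 0) =
        (\<Sum>e'\<in>in_arcs G v. if e' = e then - c / len e else 0)"
      using c by (intro sum.cong) auto
    moreover have "finite (in_arcs G v)" "finite (out_arcs G v)"
      by (auto simp: in_arcs_def out_arcs_def)
    ultimately show ?thesis using c e by (auto simp: sum.delta)
  qed
qed

section \<open>Uniqueness of potentials\<close>

text \<open>Without sources \<open>f\<close> is affine on every edge, so its vertex values are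
  harmonic at all vertices. Their energy is then zero, which makes them equal.\<close>

lemma kirchhoff_zero_constant:
  assumes "kirchhoff f (\<lambda>_. 0)" "x \<in> mg_points G len" "y \<in> mg_points G len"
  shows "f x = f y"
proof -
  from assms(1) obtain i where
    drives: "\<And>x d. x \<in> mg_points G len \<Longrightarrow> d \<in> directions G len x \<Longrightarrow> drives_current G len f d (i d)" and
    total: "\<And>x. x \<in> mg_points G len \<Longrightarrow> (\<Sum>d\<in>directions G len x. i d) = 0"
    unfolding kirchhoff_def by metis
  have right: "\<exists>\<epsilon>>0. \<forall>s. 0 \<le> s \<longrightarrow> s < \<epsilon> \<longrightarrow>
      f (edge_point G len e (t + s)) = f (edge_point G len e t) - i (e, t, 1) * s"
    if "e \<in> arcs G" "0 \<le> t" "t < len e" for e t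
    using drives[of "edge_point G len e t" "(e, t, 1)"] that
    by (force simp: directions_def drives_current_def algebra_simps)
  have left: "\<exists>\<epsilon>>0. \<forall>s. 0 \<le> s \<longrightarrow> s < \<epsilon> \<longrightarrow>
      f (edge_point G len e (t - s)) = f (edge_point G len e t) - i (e, t, -1) * s"
    if "e \<in> arcs G" "0 < t" "t \<le> len e" for e t
    using drives[of "edge_point G len e t" "(e, t, -1)"] that
    by (force simp: directions_def drives_current_def algebra_simps)
  have edge: "- i (e, 0, 1) = (f (Vertex (head G e)) - f (Vertex (tail G e))) / len e \<and>
      i (e, len e, -1) = (f (Vertex (head G e)) - f (Vertex (tail G e))) / len e \<and>
      (\<forall>t. 0 < t \<longrightarrow> t < len e \<longrightarrow> f (edge_point G len e t) = f (Vertex (tail G e)) + - i (e, 0, 1) * t)"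
    if e: "e \<in> arcs G" for e
  proof -
    have l: "0 < len e" by (rule len_pos[OF e])
    define \<phi> where "\<phi> t = f (edge_point G len e t)" for t
    \<comment> \<open>The two currents at an inner point sum to zero, so the one-sided affine pieces
      have the same slope and form one two-sided piece.\<close>
    have inner: "\<exists>\<epsilon>>0. \<exists>a. \<forall>u. \<bar>u - t\<bar> < \<epsilon> \<longrightarrow> \<phi> u = \<phi> t + a * (u - t)" if t: "0 < t" "t < len e" for t
    proof -
      from right[of e t] t e obtain \<epsilon> where \<epsilon>: "\<epsilon> > 0"
        "\<And>s. 0 \<le> s \<Longrightarrow> s < \<epsilon> \<Longrightarrow> \<phi> (t + s) = \<phi> t - i (e, t, 1) * s" unfolding \<phi>_def by auto
      from left[of e t] t e obtain \<delta> where \<delta>: "\<delta> > 0"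
        "\<And>s. 0 \<le> s \<Longrightarrow> s < \<delta> \<Longrightarrow> \<phi> (t - s) = \<phi> t - i (e, t, -1) * s" unfolding \<phi>_def by auto
      have "Inner e t \<in> mg_points G len" using e t by (auto simp: mg_points_def)
      from total[OF this] have "i (e, t, 1) + i (e, t, -1) = 0"
        using e t by (simp add: directions_Inner)
      then have i: "i (e, t, -1) = - i (e, t, 1)" by simp
      have "\<phi> u = \<phi> t + - i (e, t, 1) * (u - t)" if "\<bar>u - t\<bar> < min \<epsilon> \<delta>" for u
      proof (cases "t \<le> u")
        case True
        then show ?thesis using \<epsilon>(2)[of "u - t"] that by simp
      next
        case False
        then show ?thesis using \<delta>(2)[of "t - u"] that i by (simp add: algebra_simps)
      qed
      moreover have "0 < min \<epsilon> \<delta>" using \<epsilon>(1) \<delta>(1) by simp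
      ultimately show ?thesis by blast
    qed
    from right[of e 0] l e obtain \<epsilon> where \<epsilon>: "\<epsilon> > 0"
      "\<And>s. 0 \<le> s \<Longrightarrow> s < \<epsilon> \<Longrightarrow> \<phi> s = \<phi> 0 + - i (e, 0, 1) * s" unfolding \<phi>_def by auto
    from left[of e "len e"] l e obtain \<delta> where \<delta>: "\<delta> > 0"
      "\<And>s. 0 \<le> s \<Longrightarrow> s < \<delta> \<Longrightarrow> \<phi> (len e - s) = \<phi> (len e) - i (e, len e, -1) * s"
      unfolding \<phi>_def by auto
    from affine_if_locally_affine[OF l inner \<epsilon> \<delta>] show ?thesis
      using e by (auto simp: \<phi>_def)
  qed
  \<comment> \<open>The currents at the ends of an edge are difference quotients of vertex values,
    so Kirchhoff's law at \<open>v\<close> becomes discrete harmonicity.\<close>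
  have lap0: "lap (\<lambda>v. f (Vertex v)) v = 0" if "v \<in> verts G" for v
  proof -
    have "i (e, 0, 1) = (f (Vertex v) - f (Vertex (head G e))) / len e" if "e \<in> out_arcs G v" for e
    proof -
      have "- i (e, 0, 1) = (f (Vertex (head G e)) - f (Vertex v)) / len e"
        using edge[of e] that by auto
      then have "i (e, 0, 1) = - ((f (Vertex (head G e)) - f (Vertex v)) / len e)" by linarith
      then show ?thesis by (simp only: minus_divide_left minus_diff_eq)
    qed
    moreover have "i (e, len e, -1) = (f (Vertex v) - f (Vertex (tail G e))) / len e" if "e \<in> in_arcs G v" for e
      using edge[of e] that by auto
    ultimately have "lap (\<lambda>v. f (Vertex v)) v = (\<Sum>d\<in>directions G len (Vertex v). i d)"
      by (simp add: lap_def sum_directions_Vertex)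
    also have "\<dots> = 0" using that by (intro total) (auto simp: mg_points_def)
    finally show ?thesis .
  qed
  then have "energy (\<lambda>v. f (Vertex v)) (\<lambda>v. f (Vertex v)) = 0"
    by (simp add: energy_eq_sum_lap)
  from constant_if_energy_0[OF this]
  have const: "f (Vertex u) = f (Vertex v)" if "u \<in> verts G" "v \<in> verts G" for u v
    using that by blast
  have "\<exists>v\<in>verts G. f x = f (Vertex v)" if "x \<in> mg_points G len" for x
  proof -
    from that show ?thesis
    proof (cases rule: mg_point_cases)
      case (Inner e t)
      then have "edge_point G len e t = x" by (simp add: edge_point_def)
      then have "f x = f (Vertex (tail G e))"
        using edge[of e] Inner const[of "tail G e" "head G e"] by auto
      then show ?thesis using Inner by auto
    qed auto
  qed
  then show ?thesis using assms(2,3) const by metis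
qed

end

section \<open>The Green function and the formula for voltages\<close>

locale grounded_metrized_graph = metrized_graph +
  fixes r :: 'a and \<gamma> :: "'a \<Rightarrow> 'a \<Rightarrow> real"
  assumes green_kernel: "green_kernel r \<gamma>"
begin

lemma root_in_verts: "r \<in> verts G"
  and kernel_commute: "a \<in> verts G \<Longrightarrow> b \<in> verts G \<Longrightarrow> \<gamma> a b = \<gamma> b a"
  and kernel_root: "b \<in> verts G \<Longrightarrow> \<gamma> r b = 0"
  and lap_kernel: "a \<in> verts G \<Longrightarrow> b \<in> verts G \<Longrightarrow>
    lap (\<lambda>a. \<gamma> a b) a = of_bool (a = b) - of_bool (a = r)"
  using green_kernel unfolding green_kernel_def by blast+

lemma interp_cong:
  "x \<in> mg_points G len \<Longrightarrow> (\<And>v. v \<in> verts G \<Longrightarrow> \<phi> v = \<psi> v) \<Longrightarrow> interp \<phi> x = interp \<psi> x"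
  by (auto elim!: mg_point_cases)

lemma interp_swap: "interp (\<lambda>a. interp (\<lambda>b. F a b) y) x = interp (\<lambda>b. interp (\<lambda>a. F a b) x) y"
  by (cases x; cases y) (simp_all only: interp.simps distrib_left mult_ac add_ac)

lemma interp_sum: "interp (\<lambda>b. \<Sum>v\<in>A. F v b) x = (\<Sum>v\<in>A. interp (F v) x)"
  by (cases x) (simp_all add: sum.distrib sum_distrib_left)

lemma interp_diff_const: "interp (\<lambda>b. \<phi> b - c) x = interp \<phi> x - c"
  by (cases x) (simp_all add: algebra_simps)

lemma interp_mult_const: "interp (\<lambda>b. \<phi> b * c) x = interp \<phi> x * c"
  by (cases x) (simp_all add: algebra_simps)

text \<open>The vertex values of the Green function with source \<open>y\<close>, since
  \<open>hat\<close> vanishes at vertices.\<close>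

definition vertex_potential where
  "vertex_potential y a = interp (\<gamma> a) y"

definition green where
  "green x y = interp (vertex_potential y) x + hat x y"

lemma green_commute:
  assumes "x \<in> mg_points G len" "y \<in> mg_points G len"
  shows "green x y = green y x"
proof -
  have "interp (vertex_potential y) x = interp (\<lambda>b. interp (\<lambda>a. \<gamma> a b) x) y"
    unfolding vertex_potential_def by (rule interp_swap)
  also have "\<dots> = interp (vertex_potential x) y"
    unfolding vertex_potential_def using assms by (auto intro!: interp_cong simp: kernel_commute)
  finally show ?thesis by (simp add: green_def hat_commute)
qed

lemma green_root:
  assumes "y \<in> mg_points G len"
  shows "green (Vertex r) y = 0"
  using assms interp_cong[OF assms, of "\<gamma> r" "\<lambda>_. 0"]
  by (cases y) (auto simp: green_def vertex_potential_def kernel_root)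

text \<open>By linearity in the source, a source at \<open>y\<close> is distributed over the ends of
  its edge with the interpolation weights.\<close>

lemma lap_vertex_potential:
  assumes y: "y \<in> mg_points G len" and v: "v \<in> verts G"
  shows "lap (vertex_potential y) v = interp (\<lambda>b. of_bool (v = b)) y - of_bool (v = r)"
proof -
  have "lap (vertex_potential y) v = interp (\<lambda>b. lap (\<lambda>a. \<gamma> a b) v) y"
    unfolding vertex_potential_def by (cases y) (simp_all only: interp.simps lap_add lap_cmult)
  also have "\<dots> = interp (\<lambda>b. of_bool (v = b) - of_bool (v = r)) y"
    using y v by (intro interp_cong) (auto simp: lap_kernel)
  finally show ?thesis by (simp add: interp_diff_const)
qed

text \<open>For an inner \<open>y\<close> the interpolated part has its sources at the ends of the
  edge. The sinks of \<open>hat\<close> cancel them and leave a unit source at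
  \<open>y\<close>.\<close>

lemma kirchhoff_green:
  assumes y: "y \<in> mg_points G len"
  shows "kirchhoff (\<lambda>x. green x y) (\<lambda>x. of_bool (x = y) - of_bool (x = Vertex r))"
  using y
proof (cases rule: mg_point_cases)
  case (Vertex b)
  then have "(\<lambda>x. green x y) = interp (vertex_potential y)" by (simp add: green_def fun_eq_iff)
  moreover have "kirchhoff (interp (vertex_potential y)) (\<lambda>x. of_bool (x = y) - of_bool (x = Vertex r))"
    by (rule kirchhoff_cong_rhs[OF kirchhoff_interp], erule mg_point_cases)
       (auto simp: Vertex lap_vertex_potential[OF y, unfolded Vertex])
  ultimately show ?thesis by simp
next
  case (Inner e c)
  have "kirchhoff (\<lambda>x. 1 * interp (vertex_potential y) x + 1 * hat x y + 0)
      (\<lambda>x. of_bool (x = y) - of_bool (x = Vertex r))"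
    by (rule kirchhoff_cong_rhs[OF kirchhoff_lincomb[OF kirchhoff_interp kirchhoff_hat[OF Inner(2-4), folded Inner(1)]]],
        erule mg_point_cases)
       (auto simp: Inner(1) lap_vertex_potential[OF y, unfolded Inner(1)])
  then show ?thesis by (simp add: green_def)
qed

text \<open>The right-hand side has source \<open>y\<close> and sink \<open>z\<close>, since the
  sinks at \<open>r\<close> cancel, and it vanishes at \<open>x = z\<close>. Any other candidate
  differs from it by a source-free potential that is zero at \<open>z\<close>.\<close>

lemma voltage_eq:
  assumes x: "x \<in> mg_points G len" and y: "y \<in> mg_points G len" and z: "z \<in> mg_points G len"
  shows "voltage G len z x y = green x y - green x z - green z y + green z z"
proof -
  \<comment> \<open>The explicit coefficients give the shape \<open>a * f x + b * g x + c\<close>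
    required by \<open>kirchhoff_lincomb\<close>.\<close>
  let ?p = "\<lambda>x. 1 * green x y + (-1) * green x z + (green z z - green z y)"
  have p: "kirchhoff ?p (\<lambda>x. of_bool (x = y) - of_bool (x = z))"
    by (rule kirchhoff_cong_rhs[OF kirchhoff_lincomb[OF kirchhoff_green kirchhoff_green]]) (use y z in auto)
  have "voltage G len z x y = ?p x"
    unfolding voltage_def
  proof (rule the_equality)
    show "\<exists>f. unit_current_potential G len y z f \<and> f x = ?p x"
      using p by (intro exI[of _ ?p]) (simp add: unit_current_potential_iff)
    fix c assume "\<exists>f. unit_current_potential G len y z f \<and> f x = c"
    then obtain f where f: "f z = 0" "kirchhoff f (\<lambda>x. of_bool (x = y) - of_bool (x = z))" "f x = c"
      by (auto simp: unit_current_potential_iff)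
    have "kirchhoff (\<lambda>x. 1 * f x + (-1) * ?p x + 0) (\<lambda>_. 0)"
      by (rule kirchhoff_cong_rhs[OF kirchhoff_lincomb[OF f(2) p]]) auto
    from kirchhoff_zero_constant[OF this x z] f show "c = ?p x" by simp
  qed
  then show ?thesis by simp
qed

section \<open>Derivatives along edges\<close>

text \<open>The derivative of \<open>green x y\<close> in \<open>x\<close>: the constant slope of
  the interpolation plus that of the tent, which drops by one at \<open>c\<close>.\<close>

definition slope where
  "slope y e t = (vertex_potential y (head G e) - vertex_potential y (tail G e)) / len e +
     (case y of Vertex _ \<Rightarrow> 0 | Inner e' c \<Rightarrow> if e = e' then of_bool (t < c) - c / len e else 0)"

text \<open>The derivative of the quadratic function \<open>green x x\<close> along
  \<open>e\<close>; the part \<open>1 - 2 * t / len e\<close> comes from the tent on its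
  diagonal.\<close>

definition diag_slope where
  "diag_slope e t = (2 * (t / len e - 1) * \<gamma> (tail G e) (tail G e)
      + 2 * (1 - 2 * t / len e) * \<gamma> (tail G e) (head G e)
      + 2 * (t / len e) * \<gamma> (head G e) (head G e) - 2 * t) / len e + 1"

text \<open>Continuity together with a derivative off a finite set admits kinks at source points and
  still suffices for the fundamental theorem of calculus.\<close>

definition has_slope :: "(('a, 'b) mg_point \<Rightarrow> real) \<Rightarrow> ('b \<Rightarrow> real \<Rightarrow> real) \<Rightarrow> bool" where
  "has_slope h h' \<longleftrightarrow> (\<forall>e\<in>arcs G. continuous_on {0..len e} (\<lambda>t. h (edge_point G len e t)) \<and>
     (\<exists>S. finite S \<and> (\<forall>t\<in>{0<..<len e} - S.
        ((\<lambda>t. h (edge_point G len e t)) has_real_derivative h' e t) (at t))))"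

lemma has_slopeI:
  assumes eq: "\<And>e t. e \<in> arcs G \<Longrightarrow> 0 \<le> t \<Longrightarrow> t \<le> len e \<Longrightarrow> h (edge_point G len e t) = k e t"
    and cont: "\<And>e. e \<in> arcs G \<Longrightarrow> continuous_on {0..len e} (k e)"
    and S: "\<And>e. e \<in> arcs G \<Longrightarrow> finite (S e)"
    and der: "\<And>e t. e \<in> arcs G \<Longrightarrow> 0 < t \<Longrightarrow> t < len e \<Longrightarrow> t \<notin> S e \<Longrightarrow> (k e has_real_derivative h' e t) (at t)"
  shows "has_slope h h'"
  unfolding has_slope_def
proof (intro ballI conjI)
  fix e assume e: "e \<in> arcs G"
  show "continuous_on {0..len e} (\<lambda>t. h (edge_point G len e t))"
    using cont[OF e] by (rule continuous_on_eq) (simp add: eq e)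
  show "\<exists>S. finite S \<and> (\<forall>t\<in>{0<..<len e} - S.
        ((\<lambda>t. h (edge_point G len e t)) has_real_derivative h' e t) (at t))"
  proof (intro exI[of _ "S e"] conjI ballI S e)
    fix t assume t: "t \<in> {0<..<len e} - S e"
    show "((\<lambda>t. h (edge_point G len e t)) has_real_derivative h' e t) (at t)"
      by (rule has_field_derivative_transform_within_open[OF der[OF e], where S = "{0<..<len e}"])
         (use t e in \<open>auto simp: eq\<close>)
  qed
qed

lemma has_slope_lincomb:
  assumes "has_slope f f'" "has_slope g g'"
  shows "has_slope (\<lambda>x. a * f x + b * g x + c) (\<lambda>e t. a * f' e t + b * g' e t)"
  unfolding has_slope_def
proof (intro ballI conjI)
  fix e assume e: "e \<in> arcs G"
  with assms obtain S T where c: "continuous_on {0..len e} (\<lambda>t. f (edge_point G len e t))"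
      "continuous_on {0..len e} (\<lambda>t. g (edge_point G len e t))"
    and S: "finite S" "\<And>t. t \<in> {0<..<len e} - S \<Longrightarrow> ((\<lambda>t. f (edge_point G len e t)) has_real_derivative f' e t) (at t)"
    and T: "finite T" "\<And>t. t \<in> {0<..<len e} - T \<Longrightarrow> ((\<lambda>t. g (edge_point G len e t)) has_real_derivative g' e t) (at t)"
    unfolding has_slope_def by metis
  show "continuous_on {0..len e} (\<lambda>t. a * f (edge_point G len e t) + b * g (edge_point G len e t) + c)"
    by (intro continuous_intros c)
  have "((\<lambda>t. a * f (edge_point G len e t) + b * g (edge_point G len e t) + c)
      has_real_derivative a * f' e t + b * g' e t) (at t)" if "t \<in> {0<..<len e} - (S \<union> T)" for t
    using DERIV_add[OF DERIV_add[OF DERIV_cmult[OF S(2)] DERIV_cmult[OF T(2)]] DERIV_const] that by simp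
  with S(1) T(1) show "\<exists>S. finite S \<and> (\<forall>t\<in>{0<..<len e} - S.
      ((\<lambda>t. a * f (edge_point G len e t) + b * g (edge_point G len e t) + c)
       has_real_derivative a * f' e t + b * g' e t) (at t))"
    by (intro exI[of _ "S \<union> T"]) blast
qed

lemma continuous_on_tent: "continuous_on A (tent e c)"
  unfolding tent_def by (cases "len e = 0") (auto intro!: continuous_intros)

lemma tent_has_derivative:
  assumes "len e > 0" "t \<noteq> c"
  shows "(tent e c has_real_derivative of_bool (t < c) - c / len e) (at t)"
proof (cases "t < c")
  case True
  show ?thesis
  proof (rule has_field_derivative_transform_within_open[where S = "{..<c}"])
    show "((\<lambda>t. t * (len e - c) / len e) has_real_derivative of_bool (t < c) - c / len e) (at t)"
      using True assms by (auto intro!: derivative_eq_intros simp: field_simps)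
  qed (use True in \<open>auto simp: tent_def\<close>)
next
  case False
  show ?thesis
  proof (rule has_field_derivative_transform_within_open[where S = "{c<..}"])
    show "((\<lambda>t. c * (len e - t) / len e) has_real_derivative of_bool (t < c) - c / len e) (at t)"
      using False assms by (auto intro!: derivative_eq_intros simp: field_simps)
  qed (use False assms in \<open>auto simp: tent_def\<close>)
qed

lemma has_slope_green:
  assumes y: "y \<in> mg_points G len"
  shows "has_slope (\<lambda>x. green x y) (slope y)"
proof -
  let ?P = "vertex_potential y"
  define hat' where "hat' e t = (case y of Vertex _ \<Rightarrow> 0 | Inner e' c \<Rightarrow> if e = e' then of_bool (t < c) - c / len e else 0)"
    for e and t :: real
  have "has_slope (interp ?P) (\<lambda>e t. (?P (head G e) - ?P (tail G e)) / len e)"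
    by (rule has_slopeI[where S = "\<lambda>_. {}" and k = "\<lambda>e t. (1 - t / len e) * ?P (tail G e) + t / len e * ?P (head G e)"])
       (use interp_edge_point len_pos in \<open>auto intro!: continuous_intros derivative_eq_intros simp: field_simps dest!: len_pos\<close>)
  moreover have "has_slope (\<lambda>x. hat x y) hat'"
    using y
  proof (cases rule: mg_point_cases)
    case (Vertex v)
    then show ?thesis
      by (intro has_slopeI[where k = "\<lambda>_ _. 0" and S = "\<lambda>_. {}"]) (auto simp: hat'_def)
  next
    case (Inner e' c)
    then show ?thesis
      by (intro has_slopeI[where k = "\<lambda>e. if e = e' then tent e c else (\<lambda>_. 0)" and S = "\<lambda>_. {c}"])
         (auto simp: hat'_def hat_edge_point continuous_on_tent len_pos intro!: DERIV_cong[OF tent_has_derivative])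
  qed
  ultimately have "has_slope (\<lambda>x. 1 * interp ?P x + 1 * hat x y + 0)
     (\<lambda>e t. 1 * ((?P (head G e) - ?P (tail G e)) / len e) + 1 * hat' e t)"
    by (rule has_slope_lincomb)
  then show ?thesis by (simp add: green_def slope_def[abs_def] hat'_def[abs_def])
qed

text \<open>Both arguments move along the same edge, so the bilinear interpolation becomes a
  quadratic form in the weights \<open>1 - t / len e\<close> and \<open>t / len e\<close>; symmetry
  of \<open>\<gamma>\<close> merges its mixed terms.\<close>

lemma has_slope_diag: "has_slope (\<lambda>x. green x x) diag_slope"
proof (rule has_slopeI[where S = "\<lambda>_. {}"])
  let ?k = "\<lambda>e t. (1 - t / len e)^2 * \<gamma> (tail G e) (tail G e)
      + 2 * (t / len e) * (1 - t / len e) * \<gamma> (tail G e) (head G e)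
      + (t / len e)^2 * \<gamma> (head G e) (head G e) + t * (len e - t) / len e"
  fix e assume e: "e \<in> arcs G"
  note l = len_pos[OF e]
  have sym: "\<gamma> (head G e) (tail G e) = \<gamma> (tail G e) (head G e)"
    using e by (intro kernel_commute) auto
  show "green (edge_point G len e t) (edge_point G len e t) = ?k e t" if t: "0 \<le> t" "t \<le> len e" for t
  proof -
    have "hat (edge_point G len e t) (edge_point G len e t) = t * (len e - t) / len e"
      using l t by (auto simp: edge_point_def tent_def)
    moreover have "(1 - s) * ((1 - s) * a + s * b) + s * ((1 - s) * b + s * c) =
        (1 - s)^2 * a + 2 * s * (1 - s) * b + s^2 * c" for s a b c :: real
      by (simp add: power2_eq_square algebra_simps)
    ultimately show ?thesis
      by (simp only: green_def vertex_potential_def interp_edge_point[OF e t] sym)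
  qed
  show "continuous_on {0..len e} (?k e)" using l by (auto intro!: continuous_intros)
  show "(?k e has_real_derivative diag_slope e t) (at t)" for t
    using l by (auto intro!: derivative_eq_intros simp: diag_slope_def field_simps power2_eq_square)
qed auto

section \<open>Integration by parts\<close>

lemma root_in_mg_points: "Vertex r \<in> mg_points G len"
  using root_in_verts by (simp add: mg_points_def)

lemma has_slope_has_integral:
  assumes h: "has_slope h h'" and e: "e \<in> arcs G" and ab: "0 \<le> a" "a \<le> b" "b \<le> len e"
  shows "(h' e has_integral h (edge_point G len e b) - h (edge_point G len e a)) {a..b}"
proof -
  from h e obtain S where "continuous_on {0..len e} (\<lambda>t. h (edge_point G len e t))" and S: "finite S"
    "\<And>t. t \<in> {0<..<len e} - S \<Longrightarrow> ((\<lambda>t. h (edge_point G len e t)) has_real_derivative h' e t) (at t)"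
    unfolding has_slope_def by metis
  moreover from this(1) have "continuous_on {a..b} (\<lambda>t. h (edge_point G len e t))"
    by (rule continuous_on_subset) (use ab in auto)
  ultimately show ?thesis using ab
    by (intro fundamental_theorem_of_calculus_interior_strong[of S])
       (auto simp: has_real_derivative_iff_has_vector_derivative)
qed

text \<open>\<open>slope y\<close> is a step function on \<open>e\<close>, so \<open>h'\<close> is
  integrated against constants. The constant part gives a term of the discrete energy; the jump
  gives the excess of \<open>h y\<close> over the interpolation of the end values.\<close>

lemma slope_mult_has_integral:
  assumes h: "has_slope h h'" and y: "y \<in> mg_points G len" and e: "e \<in> arcs G"
  shows "((\<lambda>t. slope y e t * h' e t) has_integral
     (vertex_potential y (head G e) - vertex_potential y (tail G e)) *
       (h (Vertex (head G e)) - h (Vertex (tail G e))) / len e +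
     (case y of Vertex _ \<Rightarrow> 0 | Inner e' c \<Rightarrow>
        if e = e' then h y - interp (\<lambda>v. h (Vertex v)) y else 0)) {0..len e}"
proof -
  define k where "k = (vertex_potential y (head G e) - vertex_potential y (tail G e)) / len e"
  have l: "0 < len e" by (rule len_pos[OF e])
  have int: "((\<lambda>t. m * h' e t) has_integral m * (h (edge_point G len e b) - h (edge_point G len e a))) {a..b}"
    if "0 \<le> a" "a \<le> b" "b \<le> len e" for a b m
    using has_integral_mult_right[OF has_slope_has_integral[OF h e that]] .
  show ?thesis
  proof (cases "\<exists>c. y = Inner e c")
    case False
    then have "slope y e = (\<lambda>_. k)"
      by (auto simp: slope_def[abs_def] k_def split: mg_point.splits)
    moreover from False have "(case y of Vertex _ \<Rightarrow> 0 | Inner e' c \<Rightarrow>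
        if e = e' then h y - interp (\<lambda>v. h (Vertex v)) y else 0) = 0"
      by (auto split: mg_point.splits)
    ultimately show ?thesis using int[of 0 "len e" k] l e by (simp add: k_def)
  next
    case True
    then obtain c where yc: "y = Inner e c" by blast
    with y have c: "0 < c" "c < len e" by (auto simp: mg_points_def)
    have ep: "edge_point G len e c = y" using yc c by (simp add: edge_point_def)
    have sl: "slope y e t = k + of_bool (t < c) - c / len e" for t
      by (simp add: slope_def k_def yc)
    \<comment> \<open>The edge is cut at the jump. At \<open>t = c\<close> the step function already
      has its right-hand value, so \<open>c\<close> is an exceptional point of the left piece
      only.\<close>
    have "((\<lambda>t. slope y e t * h' e t) has_integral (k + 1 - c / len e) * (h y - h (Vertex (tail G e)))) {0..c}"
      by (rule has_integral_spike_finite[of "{c}" _ _ "\<lambda>t. (k + 1 - c / len e) * h' e t"])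
         (use int[of 0 c "k + 1 - c / len e"] c ep in \<open>auto simp: sl\<close>)
    moreover have "((\<lambda>t. slope y e t * h' e t) has_integral (k - c / len e) * (h (Vertex (head G e)) - h y)) {c..len e}"
      by (rule has_integral_spike_finite[of "{}" _ _ "\<lambda>t. (k - c / len e) * h' e t"])
         (use int[of c "len e" "k - c / len e"] c ep e in \<open>auto simp: sl\<close>)
    ultimately have "((\<lambda>t. slope y e t * h' e t) has_integral
        (k + 1 - c / len e) * (h y - h (Vertex (tail G e))) + (k - c / len e) * (h (Vertex (head G e)) - h y)) {0..len e}"
      using c by (intro has_integral_combine[of 0 c]) auto
    moreover have "(k + 1 - c / len e) * (h y - h (Vertex (tail G e))) + (k - c / len e) * (h (Vertex (head G e)) - h y)
      = k * (h (Vertex (head G e)) - h (Vertex (tail G e))) + (h y - interp (\<lambda>v. h (Vertex v)) y)"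
      by (simp add: yc algebra_simps)
    ultimately show ?thesis by (simp add: yc k_def)
  qed
qed

lemma energy_vertex_potential:
  assumes "y \<in> mg_points G len"
  shows "energy (vertex_potential y) \<eta> = interp \<eta> y - \<eta> r"
proof -
  have "energy (vertex_potential y) \<eta> = (\<Sum>v\<in>verts G. interp (\<lambda>b. of_bool (v = b) * \<eta> v) y - of_bool (v = r) * \<eta> v)"
    unfolding energy_eq_sum_lap
    by (rule sum.cong) (auto simp: lap_vertex_potential assms interp_mult_const left_diff_distrib)
  also have "\<dots> = interp (\<lambda>b. \<Sum>v\<in>verts G. of_bool (v = b) * \<eta> v) y - (\<Sum>v\<in>verts G. of_bool (v = r) * \<eta> v)"
    by (simp only: sum_subtractf interp_sum)
  also have "interp (\<lambda>b. \<Sum>v\<in>verts G. of_bool (v = b) * \<eta> v) y = interp \<eta> y"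
    by (rule interp_cong[OF assms]) (simp add: of_bool_def if_distrib[of "\<lambda>x. x * _"] cong: if_cong)
  also have "(\<Sum>v\<in>verts G. of_bool (v = r) * \<eta> v) = \<eta> r"
    using root_in_verts by (simp add: of_bool_def if_distrib[of "\<lambda>x. x * _"] cong: if_cong)
  finally show ?thesis .
qed

text \<open>The reproducing property of the Green function: the discrete energy yields the
  interpolation of the vertex values of \<open>h\<close> at \<open>y\<close>, and the correction on
  the edge of \<open>y\<close> turns it into \<open>h y\<close>.\<close>

lemma integral_slope_mult:
  assumes h: "has_slope h h'" and y: "y \<in> mg_points G len"
  shows "mg_integral G len (\<lambda>e t. slope y e t * h' e t) = h y - h (Vertex r)"
proof -
  let ?\<eta> = "\<lambda>v. h (Vertex v)"
  have "mg_integral G len (\<lambda>e t. slope y e t * h' e t) = energy (vertex_potential y) ?\<eta> +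
     (\<Sum>e\<in>arcs G. case y of Vertex _ \<Rightarrow> 0 | Inner e' c \<Rightarrow> if e = e' then h y - interp ?\<eta> y else 0)"
    unfolding mg_integral_def energy_def sum.distrib[symmetric]
    by (intro sum.cong refl integral_unique slope_mult_has_integral assms)
  also have "(\<Sum>e\<in>arcs G. case y of Vertex _ \<Rightarrow> 0 | Inner e' c \<Rightarrow> if e = e' then h y - interp ?\<eta> y else 0)
     = h y - interp ?\<eta> y"
    using y by (cases rule: mg_point_cases) (auto simp: sum.delta)
  finally show ?thesis by (simp add: energy_vertex_potential[OF y])
qed

lemma slope_mult_integrable:
  assumes "has_slope h h'" "y \<in> mg_points G len" "e \<in> arcs G"
  shows "(\<lambda>t. slope y e t * h' e t) integrable_on {0..len e}"
  using slope_mult_has_integral[OF assms] by blast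

lemma diag_slope_sq_integrable:
  assumes "e \<in> arcs G"
  shows "(\<lambda>t. (diag_slope e t)\<^sup>2) integrable_on {0..len e}"
  using len_pos[OF assms] unfolding diag_slope_def
  by (intro integrable_continuous_interval continuous_intros) auto

section \<open>Squared derivatives and the tau constant\<close>

lemma mg_integral_add:
  assumes "\<And>e. e \<in> arcs G \<Longrightarrow> f e integrable_on {0..len e}" "\<And>e. e \<in> arcs G \<Longrightarrow> g e integrable_on {0..len e}"
  shows "mg_integral G len (\<lambda>e t. f e t + g e t) = mg_integral G len f + mg_integral G len g"
  unfolding mg_integral_def sum.distrib[symmetric]
  by (intro sum.cong refl integral_add assms)

lemma mg_integral_cmult: "mg_integral G len (\<lambda>e t. c * f e t) = c * mg_integral G len f"
  unfolding mg_integral_def by (simp add: sum_distrib_left)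

lemma mg_integral_edge_deriv:
  assumes "has_slope h h'" and eq: "\<And>x. x \<in> mg_points G len \<Longrightarrow> f x = h x"
  shows "mg_integral G len (\<lambda>e t. (edge_deriv G len f e t)\<^sup>2) = mg_integral G len (\<lambda>e t. (h' e t)\<^sup>2)"
  unfolding mg_integral_def
proof (intro sum.cong refl)
  fix e assume e: "e \<in> arcs G"
  have fh: "(\<lambda>t. f (edge_point G len e t)) = (\<lambda>t. h (edge_point G len e t))"
    using eq e by auto
  from assms(1) e obtain S where S: "finite S"
    "\<And>t. t \<in> {0<..<len e} - S \<Longrightarrow> ((\<lambda>t. h (edge_point G len e t)) has_real_derivative h' e t) (at t)"
    unfolding has_slope_def by metis
  show "integral {0..len e} (\<lambda>t. (edge_deriv G len f e t)\<^sup>2) = integral {0..len e} (\<lambda>t. (h' e t)\<^sup>2)"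
  proof (rule integral_spike)
    \<comment> \<open>The end parameters are excluded as well, because the two-sided derivative is
      known only inside the edge.\<close>
    show "negligible (S \<union> {0, len e})" using S(1) by (simp add: negligible_finite)
    fix t assume "t \<in> {0..len e} - (S \<union> {0, len e})"
    then have "t \<in> {0<..<len e} - S" by auto
    from DERIV_imp_deriv[OF S(2)[OF this]]
    show "(h' e t)\<^sup>2 = (edge_deriv G len f e t)\<^sup>2" by (simp add: edge_deriv_def fh)
  qed
qed

lemma integral_voltage_deriv_sq:
  assumes p: "p \<in> mg_points G len" and q: "q \<in> mg_points G len"
  shows "mg_integral G len (\<lambda>e t. (edge_deriv G len (\<lambda>x. voltage G len x p q) e t)\<^sup>2) =
     mg_integral G len (\<lambda>e t. (diag_slope e t)\<^sup>2) - resistance G len p q"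
proof -
  let ?Q = diag_slope and ?P = "slope p" and ?R = "slope q"
  \<comment> \<open>The expanded square is grouped so that every term except the square of
    \<open>?Q\<close> has \<open>?P\<close> or \<open>?R\<close> as a factor and is evaluated by
    \<open>integral_slope_mult\<close>.\<close>
  let ?PQ = "\<lambda>e t. ?P e t * (1 * ?P e t + (-2) * ?Q e t)" and ?RQ = "\<lambda>e t. ?R e t * (1 * ?R e t + (-2) * ?Q e t)"
    and ?PR = "\<lambda>e t. ?P e t * ?R e t"
  note gp = has_slope_green[OF p] and gq = has_slope_green[OF q]
  have s: "has_slope (\<lambda>x. 1 * green x x + (-1) * (1 * green x p + 1 * green x q + 0) + green p q)
     (\<lambda>e t. 1 * ?Q e t + (-1) * (1 * ?P e t + 1 * ?R e t))"
    by (intro has_slope_lincomb has_slope_diag gp gq)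
  have "mg_integral G len (\<lambda>e t. (edge_deriv G len (\<lambda>x. voltage G len x p q) e t)\<^sup>2) =
     mg_integral G len (\<lambda>e t. (1 * ?Q e t + (-1) * (1 * ?P e t + 1 * ?R e t))\<^sup>2)"
    by (rule mg_integral_edge_deriv[OF s]) (simp add: voltage_eq p q green_commute[OF p])
  also have "(\<lambda>e t. (1 * ?Q e t + (-1) * (1 * ?P e t + 1 * ?R e t))\<^sup>2) =
     (\<lambda>e t. (?Q e t)\<^sup>2 + (?PQ e t + (?RQ e t + 2 * ?PR e t)))"
    by (simp add: fun_eq_iff power2_eq_square algebra_simps)
  also have "mg_integral G len \<dots> = mg_integral G len (\<lambda>e t. (?Q e t)\<^sup>2) +
      (mg_integral G len ?PQ + (mg_integral G len ?RQ + 2 * mg_integral G len ?PR))"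
  proof -
    have i: "?PQ e integrable_on {0..len e}" "?RQ e integrable_on {0..len e}"
      "(\<lambda>t. 2 * ?PR e t) integrable_on {0..len e}" "(\<lambda>t. (?Q e t)\<^sup>2) integrable_on {0..len e}" if e: "e \<in> arcs G" for e
      using slope_mult_integrable[OF has_slope_lincomb[OF gp has_slope_diag] p e, of 1 "-2"]
        slope_mult_integrable[OF has_slope_lincomb[OF gq has_slope_diag] q e, of 1 "-2"]
        integrable_on_cmult_left[OF slope_mult_integrable[OF gq p e], of 2] diag_slope_sq_integrable[OF e]
      by auto
    show ?thesis
      by (simp only: mg_integral_add mg_integral_cmult i integrable_add)
  qed
  \<comment> \<open>Here \<open>h x\<close> is \<open>green x p - 2 * green x x\<close>, which is
    \<open>- green p p\<close> at \<open>p\<close> and zero at the root.\<close>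
  also have "mg_integral G len ?PQ = - green p p"
    using integral_slope_mult[OF has_slope_lincomb[OF gp has_slope_diag] p, of 1 "-2" 0]
    by (simp add: green_root p root_in_mg_points)
  also have "mg_integral G len ?RQ = - green q q"
    using integral_slope_mult[OF has_slope_lincomb[OF gq has_slope_diag] q, of 1 "-2" 0]
    by (simp add: green_root q root_in_mg_points)
  also have "mg_integral G len ?PR = green p q"
    using integral_slope_mult[OF gq p] by (simp add: green_root q)
  finally show ?thesis
    by (simp add: resistance_def voltage_eq p q green_commute[OF q p])
qed

text \<open>The resistance \<open>r(x, y)\<close> is \<open>j_x(y, y)\<close>, so the previous
  identity with equal points applies, and its correction \<open>r(y, y)\<close> is zero. Every base
  point thus gives the same integral; the root serves as a base point for uniqueness.\<close>

lemma tau_eq: "tau G len = 1/4 * mg_integral G len (\<lambda>e t. (diag_slope e t)\<^sup>2)"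
  unfolding tau_def
proof (rule the_equality)
  have "resistance G len y y = 0" if "y \<in> mg_points G len" for y
    using that by (simp add: resistance_def voltage_eq)
  then have eq: "mg_integral G len (\<lambda>e t. (edge_deriv G len (\<lambda>x. resistance G len x y) e t)\<^sup>2) =
     mg_integral G len (\<lambda>e t. (diag_slope e t)\<^sup>2)" if "y \<in> mg_points G len" for y
    using integral_voltage_deriv_sq[OF that that] that by (simp add: resistance_def)
  then show "\<forall>y\<in>mg_points G len. 1/4 * mg_integral G len (\<lambda>e t. (diag_slope e t)\<^sup>2) =
    1/4 * mg_integral G len (\<lambda>e t. (edge_deriv G len (\<lambda>x. resistance G len x y) e t)\<^sup>2)"
    by simp
  fix c assume "\<forall>y\<in>mg_points G len.
     c = 1/4 * mg_integral G len (\<lambda>e t. (edge_deriv G len (\<lambda>x. resistance G len x y) e t)\<^sup>2)"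
  then show "c = 1/4 * mg_integral G len (\<lambda>e t. (diag_slope e t)\<^sup>2)"
    using eq root_in_mg_points by metis
qed

end

theorem theorem2p21:
  fixes G :: "('v, 'e) pre_digraph" and len :: "'e \<Rightarrow> real"
    and p q :: "('v, 'e) mg_point"
  assumes "metrized_graph G len"
    and "p \<in> mg_points G len" and "q \<in> mg_points G len"
  shows "tau G len =
    1/4 * mg_integral G len (\<lambda>e t. (edge_deriv G len (\<lambda>x. voltage G len x p q) e t)\<^sup>2)
    + 1/4 * resistance G len p q"
proof -
  interpret metrized_graph G len by (rule assms(1))
  obtain r \<gamma> where "green_kernel r \<gamma>" using green_kernel_exists by blast
  then interpret grounded_metrized_graph G len r \<gamma> by unfold_locales
  show ?thesis using tau_eq integral_voltage_deriv_sq[OF assms(2,3)] by linarith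
qed

end
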